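(* Let $\mathcal S$ be an uncountable set of pairwise future-distinguishable states and let $E:\mathcal S\to\mathbb R^d$ be an encoding (any map). Then there do not exist a deterministic decoder $C:\mathbb R^d\to\mathcal S$ and $\epsilon>0$ satisfying $$C(E(s)+\eta)=s\qquad\text{for all }s\in\mathcal S\text{ and all }\eta\in\mathbb R^d\text{ with }\lVert\eta\rVert\le\epsilon.$$
   Context: $d$ is a fixed finite dimension and $\lVert\cdot\rVert$ is a norm on $\mathbb R^d$. States are "pairwise future-distinguishable" when distinct elements of $\mathcal S$ have different vectors of conditional expected outcomes $(\phi_w(s))_{w\in\mathcal W}$ over the family $\mathcal W$ of future tests, with each $\phi_w(s)\in[0,1]$. *)

theory Defs
  imports "HOL-Analysis.Analysis"
begin

(* An arbitrary norm on a real vector space, independent of the norm fixed by the type class. *)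
definition norm_on_space :: "('v::real_vector \<Rightarrow> real) \<Rightarrow> bool" where
  "norm_on_space N \<longleftrightarrow>
     (\<forall>x. 0 \<le> N x) \<and>
     (\<forall>x. N x = 0 \<longleftrightarrow> x = 0) \<and>
     (\<forall>a x. N (a *\<^sub>R x) = \<bar>a\<bar> * N x) \<and>
     (\<forall>x y. N (x + y) \<le> N x + N y)"

(* The vector of expected outcomes of the state s, indexed by the tests in W; phi w s is the
   conditional expected outcome of the test w given s. Restricting to W makes equality of two
   such vectors mean agreement on W only. *)
definition outcome_vector :: "('w \<Rightarrow> 's \<Rightarrow> real) \<Rightarrow> 'w set \<Rightarrow> 's \<Rightarrow> 'w \<Rightarrow> real" where
  "outcome_vector \<phi> W s = (\<lambda>w\<in>W. \<phi> w s)"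

definition pairwise_future_distinguishable ::
    "('w \<Rightarrow> 's \<Rightarrow> real) \<Rightarrow> 'w set \<Rightarrow> 's set \<Rightarrow> bool" where
  "pairwise_future_distinguishable \<phi> W S \<longleftrightarrow>
     pairwise (\<lambda>s t. outcome_vector \<phi> W s \<noteq> outcome_vector \<phi> W t) S"

end

theory Submission
  imports Defs
begin

text \<open>
  A norm on a finite-dimensional space is dominated by a multiple of the Euclidean one, so the error
  balls around the encoded states contain Euclidean balls. Each of these meets a fixed countable
  dense set \<open>D\<close>, whence \<open>C\<close> maps \<open>D\<close> onto a superset of \<open>S\<close>.
\<close>

text \<open>Expanding \<open>x\<close> in the orthonormal \<open>Basis\<close> and applying the
  triangle inequality bounds \<open>N x\<close> by a sum of terms
  \<open>\<bar>x \<bullet> b\<bar> * N b\<close>, where each coordinate is at most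
  \<open>norm x\<close> in absolute value.\<close>

lemma norm_on_space_le_norm:
  fixes N :: "'a::euclidean_space \<Rightarrow> real"
  assumes "norm_on_space N"
  shows "\<exists>K>0. \<forall>x. N x \<le> K * norm x"
proof -
  have nonneg: "0 \<le> N x" and zero: "N 0 = 0" and scale: "N (a *\<^sub>R x) = \<bar>a\<bar> * N x"
    and triangle: "N (x + y) \<le> N x + N y" for a x y
    using assms unfolding norm_on_space_def by simp_all
  \<comment> \<open>The sum is the constant that the basis expansion yields; adding 1 makes
    \<open>K\<close> positive from nonnegativity of \<open>N\<close> alone, so that \<open>K\<close>
    can later serve as a divisor.\<close>
  define K where "K = (\<Sum>b\<in>Basis. N b) + 1"
  have "K > 0"
    using nonneg unfolding K_def by (simp add: sum_nonneg add_nonneg_pos)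
  moreover have "N x \<le> K * norm x" for x
  proof -
    have sum_le: "N (sum f A) \<le> (\<Sum>b\<in>A. N (f b))" if "finite A" for f :: "'a \<Rightarrow> 'a" and A
      using that
    proof induction
      case empty
      then show ?case by (simp add: zero)
    next
      case (insert b A)
      then show ?case using triangle[of "f b" "sum f A"] by simp
    qed
    have "N x = N (\<Sum>b\<in>Basis. (x \<bullet> b) *\<^sub>R b)"
      by (simp add: euclidean_representation)
    also have "\<dots> \<le> (\<Sum>b\<in>Basis. N ((x \<bullet> b) *\<^sub>R b))"
      by (rule sum_le) simp
    also have "\<dots> \<le> (\<Sum>b\<in>Basis. norm x * N b)"
      by (intro sum_mono) (simp add: scale Basis_le_norm mult_right_mono nonneg)
    also have "\<dots> \<le> K * norm x"
      by (simp add: K_def algebra_simps sum_distrib_left)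
    finally show ?thesis .
  qed
  ultimately show ?thesis by blast
qed

lemma countable_if_decodable:
  fixes E :: "'s \<Rightarrow> 'a::euclidean_space"
  assumes "norm_on_space N" "\<epsilon> > 0"
    and decode: "\<And>s \<eta>. s \<in> S \<Longrightarrow> N \<eta> \<le> \<epsilon> \<Longrightarrow> C (E s + \<eta>) = s"
  shows "countable S"
proof -
  obtain K where K: "K > 0" "\<And>x. N x \<le> K * norm x"
    using norm_on_space_le_norm[OF assms(1)] by blast
  \<comment> \<open>\<open>D\<close> is chosen before any state, so one countable set serves all of
    \<open>S\<close>.\<close>
  obtain D :: "'a set" where D: "countable D"
    "\<And>X. open X \<Longrightarrow> X \<noteq> {} \<Longrightarrow> \<exists>d\<in>D. d \<in> X"
    using countable_dense_setE by blast
  have "s \<in> C ` D" if "s \<in> S" for s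
  proof -
    \<comment> \<open>The radius \<open>\<epsilon> / K\<close> makes the Euclidean ball around
      \<open>E s\<close> lie within the \<open>N\<close>-ball of radius
      \<open>\<epsilon>\<close>.\<close>
    have "0 < \<epsilon> / K"
      using \<open>\<epsilon> > 0\<close> \<open>K > 0\<close> by (rule divide_pos_pos)
    then have "ball (E s) (\<epsilon> / K) \<noteq> {}"
      by simp
    then obtain d where d: "d \<in> D" "dist (E s) d < \<epsilon> / K"
      using D(2)[OF open_ball] by auto
    have "N (d - E s) \<le> K * norm (d - E s)"
      by (rule K)
    also have "\<dots> \<le> \<epsilon>"
      using d(2) \<open>K > 0\<close> by (simp add: dist_norm norm_minus_commute field_simps)
    \<comment> \<open>The dense point \<open>d\<close> is read as a noisy copy of
      \<open>E s\<close>, with error \<open>d - E s\<close> within the tolerance.\<close>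
    finally have "C d = s"
      using decode[OF that, of "d - E s"] by simp
    with d(1) show ?thesis by blast
  qed
  then have "S \<subseteq> C ` D" by blast
  then show ?thesis
    using D(1) by (rule countable_subset[OF _ countable_image])
qed

theorem theorem3:
  fixes S :: "'s set"
    and W :: "'w set"
    and \<phi> :: "'w \<Rightarrow> 's \<Rightarrow> real"
    and N :: "real ^ 'd \<Rightarrow> real"
    and E :: "'s \<Rightarrow> real ^ 'd"
  assumes "norm_on_space N"
    and "\<And>w s. w \<in> W \<Longrightarrow> s \<in> S \<Longrightarrow> \<phi> w s \<in> {0..1}"
    and "uncountable S"
    and "pairwise_future_distinguishable \<phi> W S"
  shows "\<not> (\<exists>(C :: real ^ 'd \<Rightarrow> 's) \<epsilon> :: real.
            C \<in> UNIV \<rightarrow> S \<and> \<epsilon> > 0 \<and>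
            (\<forall>s\<in>S. \<forall>\<eta>. N \<eta> \<le> \<epsilon> \<longrightarrow> C (E s + \<eta>) = s))"
proof (intro notI, elim exE conjE)
  fix C :: "real ^ 'd \<Rightarrow> 's" and \<epsilon> :: real
  assume "\<epsilon> > 0" "\<forall>s\<in>S. \<forall>\<eta>. N \<eta> \<le> \<epsilon> \<longrightarrow> C (E s + \<eta>) = s"
  then have "countable S"
    by (intro countable_if_decodable[OF assms(1), where C = C and E = E]) blast+
  with assms(3) show False by contradiction
qed

end
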